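(* For all integers $t \geq 3$ and $k \geq 3$ (and every positive integer $n$), $$\mathrm{ex}(n;\, C_k,\, K_{1,t}\text{-ind}) \leq \frac{1}{2}(k-2)(t-1)\,n,$$ and, for each such $t$ and $k$, equality holds for infinitely many values of $n$.
   Context: All graphs are finite and simple. For graphs $H$ and $G$, $\mathrm{ex}(n;\, H,\, G\text{-ind})$ denotes the maximum number of edges in an $n$-vertex graph that contains no subgraph (not necessarily induced) isomorphic to $H$ and no induced subgraph isomorphic to $G$. $C_k$ is the cycle of length $k$ and $K_{1,t}$ is the star with $t$ leaves. *)

theory Defs
  imports Complex_Main
begin

type_synonym 'a graph = "'a set \<times> 'a set set"

abbreviation verts :: "'a graph \<Rightarrow> 'a set" where
  "verts G \<equiv> fst G"

abbreviation edges :: "'a graph \<Rightarrow> 'a set set" where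
  "edges G \<equiv> snd G"

definition simple_graph :: "'a graph \<Rightarrow> bool" where
  "simple_graph G \<longleftrightarrow> finite (verts G) \<and> (\<forall>e\<in>edges G. e \<subseteq> verts G \<and> card e = 2)"

definition graph_iso :: "'a graph \<Rightarrow> 'b graph \<Rightarrow> bool" where
  "graph_iso G H \<longleftrightarrow> (\<exists>f. bij_betw f (verts G) (verts H) \<and> (\<lambda>e. f ` e) ` edges G = edges H)"

definition subgraph :: "'a graph \<Rightarrow> 'a graph \<Rightarrow> bool" where
  "subgraph S G \<longleftrightarrow> simple_graph S \<and> verts S \<subseteq> verts G \<and> edges S \<subseteq> edges G"

definition induced :: "'a graph \<Rightarrow> 'a set \<Rightarrow> 'a graph" where
  "induced G W = (W, {e \<in> edges G. e \<subseteq> W})"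

definition has_subgraph :: "'a graph \<Rightarrow> 'b graph \<Rightarrow> bool" where
  "has_subgraph G H \<longleftrightarrow> (\<exists>S. subgraph S G \<and> graph_iso S H)"

definition has_induced_subgraph :: "'a graph \<Rightarrow> 'b graph \<Rightarrow> bool" where
  "has_induced_subgraph G H \<longleftrightarrow> (\<exists>W \<subseteq> verts G. graph_iso (induced G W) H)"

(* For k < 3 this is not a simple graph; it is only meant for k at least 3. *)
definition cycle :: "nat \<Rightarrow> nat graph" where
  "cycle k = ({..<k}, {{i, (i + 1) mod k} | i. i < k})"

(* K_{1,t}: the centre is 0, the leaves are 1, ..., t. *)
definition star :: "nat \<Rightarrow> nat graph" where
  "star t = ({0..t}, {{0, i} | i. 1 \<le> i \<and> i \<le> t})"

(* Taking vertices in nat loses nothing, as every finite graph has an isomorphic copy there. *)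
definition admissible :: "nat \<Rightarrow> 'a graph \<Rightarrow> 'b graph \<Rightarrow> nat graph set" where
  "admissible n H G = {F. simple_graph F \<and> card (verts F) = n
     \<and> \<not> has_subgraph F H \<and> \<not> has_induced_subgraph F G}"

(* ex(n; H, G-ind). The maximum is over a finite set (finite_edge_counts), which is
   nonempty for H = cycle k and G = star t with k, t at least 3 (admissible_nonempty). *)
definition ex_ind :: "nat \<Rightarrow> 'a graph \<Rightarrow> 'b graph \<Rightarrow> nat" where
  "ex_ind n H G = Max ((\<lambda>F. card (edges F)) ` admissible n H G)"

lemma finite_edge_counts: "finite ((\<lambda>F. card (edges F)) ` admissible n H G)"
proof (rule finite_subset)
  show "(\<lambda>F. card (edges F)) ` admissible n H G \<subseteq> {..2 ^ n}"
  proof clarsimp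
    fix V and E :: "nat set set"
    assume "(V, E) \<in> admissible n H G"
    then have V: "finite V" "card V = n" and "E \<subseteq> Pow V"
      by (auto simp: admissible_def simple_graph_def)
    then have "card E \<le> card (Pow V)" by (intro card_mono) auto
    then show "card E \<le> 2 ^ n" using V by (simp add: card_Pow)
  qed
qed simp

lemma simple_graph_cycle:
  assumes "k \<ge> 3" shows "simple_graph (cycle k)"
proof -
  have "(i + 1) mod k \<noteq> i" if "i < k" for i
    using assms that by (cases "i + 1 = k") auto
  then show ?thesis using assms by (auto simp: simple_graph_def cycle_def card_2_iff)
qed

lemma simple_graph_star: "simple_graph (star t)"
  by (auto simp: simple_graph_def star_def)

lemma admissible_nonempty:
  assumes "k \<ge> 3" "t \<ge> 3"
  shows "admissible n (cycle k) (star t) \<noteq> {}"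
proof -
  have "edges (cycle k) \<noteq> {}" "edges (star t) \<noteq> {}"
    using assms by (auto simp: cycle_def star_def intro!: exI[of _ "1::nat"])
  then have "({..<n}, {}) \<in> admissible n (cycle k) (star t)"
    by (auto simp: admissible_def simple_graph_def has_subgraph_def subgraph_def
        has_induced_subgraph_def induced_def graph_iso_def)
  then show ?thesis by blast
qed

end

theory Submission
  imports Defs "HOL-Combinatorics.Permutations"
begin

text \<open>If \<open>C\<^sub>k\<close> is excluded, the neighbourhood of a vertex contains no path on \<open>k - 1\<close> vertices, so
  successively removing maximal independent sets exhausts it in \<open>k - 2\<close> rounds; if the induced star
  is excluded too, each round removes at most \<open>t - 1\<close> vertices, and every degree is at most
  \<open>(k - 2) (t - 1)\<close>.

  Equality requires a regular graph in which every vertex lies in \<open>t - 1\<close> cliques of size \<open>k - 1\<close>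
  meeting only there, and without cycles of length \<open>k\<close>. Such a graph is obtained by letting \<open>t - 1\<close>
  copies of the cyclic group of order \<open>k - 1\<close> act on a finite set of words, such that a short reduced
  word of the free product does not fix the empty word. The vertices are the permutations of a finite
  superset of this set of words, and the cliques are the cosets of the cyclic groups. Enlarging the
  superset gives infinitely many orders.\<close>

section \<open>Embeddings of graphs\<close>

text \<open>The bijection is controlled only on vertices; its inverse undoes it on edges because
  these consist of vertices.\<close>

lemma graph_iso_sym:
  assumes "graph_iso G H" "edges G \<subseteq> Pow (verts G)"
  shows "graph_iso H G"
proof -
  obtain f where f: "bij_betw f (verts G) (verts H)" and E: "(\<lambda>e. f ` e) ` edges G = edges H"
    using assms(1) unfolding graph_iso_def by blast
  define g where "g = the_inv_into (verts G) f"
  have g: "g ` f ` e = e" if "e \<in> edges G" for e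
  proof -
    have "g (f x) = x" if "x \<in> e" for x
      using that \<open>e \<in> edges G\<close> assms(2) f the_inv_into_f_f[of f "verts G" x]
      by (auto simp: g_def bij_betw_def)
    then show ?thesis by (force simp: image_iff)
  qed
  have "(\<lambda>e. g ` e) ` edges H = (\<lambda>e. g ` f ` e) ` edges G"
    unfolding E[symmetric] by (simp add: image_image)
  also have "\<dots> = edges G" using g by simp
  finally show ?thesis
    unfolding graph_iso_def using bij_betw_the_inv_into[OF f] g_def by blast
qed

text \<open>Turning the isomorphism around makes a copy of \<open>H\<close> an injective map out of
  the fixed graph \<open>H\<close>, whose image is the subgraph.\<close>

lemma has_subgraph_iff_embedding:
  assumes "simple_graph H"
  shows "has_subgraph G H \<longleftrightarrow>
    (\<exists>f. inj_on f (verts H) \<and> f ` verts H \<subseteq> verts G \<and> (\<forall>e\<in>edges H. f ` e \<in> edges G))"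
proof
  assume "has_subgraph G H"
  then obtain S where S: "subgraph S G" "graph_iso S H" unfolding has_subgraph_def by blast
  then have "graph_iso H S"
    using S by (intro graph_iso_sym[of S H]) (auto simp: subgraph_def simple_graph_def)
  then obtain f where "bij_betw f (verts H) (verts S)" "(\<lambda>e. f ` e) ` edges H = edges S"
    unfolding graph_iso_def by blast
  with S(1) show "\<exists>f. inj_on f (verts H) \<and> f ` verts H \<subseteq> verts G \<and> (\<forall>e\<in>edges H. f ` e \<in> edges G)"
    unfolding subgraph_def bij_betw_def by (intro exI[of _ f]) blast
next
  assume "\<exists>f. inj_on f (verts H) \<and> f ` verts H \<subseteq> verts G \<and> (\<forall>e\<in>edges H. f ` e \<in> edges G)"
  then obtain f where f: "inj_on f (verts H)" "f ` verts H \<subseteq> verts G" "\<forall>e\<in>edges H. f ` e \<in> edges G"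
    by blast
  define S where "S = (f ` verts H, (\<lambda>e. f ` e) ` edges H)"
  have "card (f ` e) = 2" if "e \<in> edges H" for e
    using that assms f(1) by (metis card_image inj_on_subset simple_graph_def)
  then have "subgraph S G"
    using assms f unfolding subgraph_def simple_graph_def S_def by (auto intro!: imageI)
  moreover have "graph_iso H S"
    using f(1) unfolding graph_iso_def S_def by (intro exI[of _ f]) (simp add: bij_betw_def)
  then have "graph_iso S H"
    using assms by (intro graph_iso_sym[of H S]) (auto simp: simple_graph_def)
  ultimately show "has_subgraph G H" unfolding has_subgraph_def by blast
qed

lemma has_induced_subgraph_iff_embedding:
  assumes "simple_graph H"
  shows "has_induced_subgraph G H \<longleftrightarrow>
    (\<exists>f. inj_on f (verts H) \<and> f ` verts H \<subseteq> verts G \<and>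
      (\<lambda>e. f ` e) ` edges H = {e \<in> edges G. e \<subseteq> f ` verts H})"
proof -
  have "graph_iso (induced G W) H \<longleftrightarrow> graph_iso H (induced G W)" for W
    using assms graph_iso_sym[of "induced G W" H] graph_iso_sym[of H "induced G W"]
    by (auto simp: simple_graph_def induced_def)
  then have "has_induced_subgraph G H \<longleftrightarrow> (\<exists>W \<subseteq> verts G. graph_iso H (induced G W))"
    unfolding has_induced_subgraph_def by simp
  also have "\<dots> \<longleftrightarrow> (\<exists>f. inj_on f (verts H) \<and> f ` verts H \<subseteq> verts G \<and>
      (\<lambda>e. f ` e) ` edges H = {e \<in> edges G. e \<subseteq> f ` verts H})"
    (is "?l \<longleftrightarrow> ?r")
  proof
    assume ?l
    then obtain W f where "W \<subseteq> verts G" "inj_on f (verts H)" "f ` verts H = W"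
        "(\<lambda>e. f ` e) ` edges H = {e \<in> edges G. e \<subseteq> W}"
      by (auto simp: graph_iso_def induced_def bij_betw_def)
    then show ?r by (intro exI[of _ f]) simp
  next
    assume ?r
    then obtain f where "inj_on f (verts H)" "f ` verts H \<subseteq> verts G"
        "(\<lambda>e. f ` e) ` edges H = {e \<in> edges G. e \<subseteq> f ` verts H}" by blast
    then show ?l
      by (intro exI[of _ "f ` verts H"] conjI) (auto simp: graph_iso_def induced_def bij_betw_def)
  qed
  finally show ?thesis .
qed

section \<open>Stars, cycles and degrees in concrete terms\<close>

lemma edges_star: "edges (star t) = (\<lambda>i. {0, i}) ` {1..t}"
  by (auto simp: star_def)

lemma inj_on_star_insert:
  assumes "v \<notin> S" "bij_betw g {1..t} S"
  shows "inj_on (g(0 := v)) {0..t::nat}"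
proof -
  have "inj_on (g(0 := v)) {1..t} \<longleftrightarrow> inj_on g {1..t}" by (rule inj_on_cong) auto
  moreover have "(g(0 := v)) ` {1..t} = g ` {1..t}" by (rule image_cong) auto
  moreover have "{0..t} = insert 0 {1..t}" by auto
  ultimately show ?thesis using assms by (simp add: bij_betw_def)
qed

definition nbrs :: "'a graph \<Rightarrow> 'a \<Rightarrow> 'a set" where
  "nbrs G v = {w. {v, w} \<in> edges G}"

text \<open>Taking \<open>x = y\<close> asks that \<open>{x}\<close> is not an edge, which holds in
  every simple graph.\<close>

definition indep :: "'a graph \<Rightarrow> 'a set \<Rightarrow> bool" where
  "indep G S \<longleftrightarrow> (\<forall>x\<in>S. \<forall>y\<in>S. {x, y} \<notin> edges G)"

lemma simple_graph_edge:
  assumes "simple_graph G" "{x, y} \<in> edges G"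
  shows "x \<in> verts G" "y \<in> verts G" "x \<noteq> y"
  using assms unfolding simple_graph_def by force+

lemma nbrs_subset: "simple_graph G \<Longrightarrow> nbrs G v \<subseteq> verts G - {v}"
  using simple_graph_edge unfolding nbrs_def by fast

lemma has_induced_star_iff:
  assumes "simple_graph G"
  shows "has_induced_subgraph G (star t) \<longleftrightarrow>
    (\<exists>v\<in>verts G. \<exists>S \<subseteq> nbrs G v. finite S \<and> card S = t \<and> indep G S)"
proof
  assume "has_induced_subgraph G (star t)"
  then obtain f where f: "inj_on f {0..t}" "f ` {0..t} \<subseteq> verts G"
      and E: "(\<lambda>e. f ` e) ` edges (star t) = {e \<in> edges G. e \<subseteq> f ` {0..t}}"
    unfolding has_induced_subgraph_iff_embedding[OF simple_graph_star] by (auto simp: star_def)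
  define S where "S = f ` {1..t}"
  have "{f 0, f i} \<in> edges G" if "i \<in> {1..t}" for i
  proof -
    have "f ` {0, i} \<in> (\<lambda>e. f ` e) ` edges (star t)"
      using that by (intro imageI) (auto simp: star_def)
    then show ?thesis using E by auto
  qed
  then have 1: "S \<subseteq> nbrs G (f 0)" by (auto simp: S_def nbrs_def)
  have 2: "card S = t"
    using f(1) unfolding S_def by (subst card_image) (auto intro: inj_on_subset)
  have "{f i, f j} \<notin> edges G" if "i \<in> {1..t}" "j \<in> {1..t}" for i j
  proof
    \<comment> \<open>Every edge of the star contains the centre, so an edge between two leaves
      would identify one of them with it.\<close>
    assume "{f i, f j} \<in> edges G"
    then have "{f i, f j} \<in> (\<lambda>e. f ` e) ` edges (star t)" using E that by auto
    then obtain l where "l \<in> {1..t}" "{f i, f j} = {f 0, f l}" by (auto simp: star_def)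
    then have "f i = f 0 \<or> f j = f 0" by (auto simp: doubleton_eq_iff)
    then show False using inj_onD[OF f(1), of _ 0] that by fastforce
  qed
  then have 3: "indep G S" by (auto simp: indep_def S_def)
  show "\<exists>v\<in>verts G. \<exists>S \<subseteq> nbrs G v. finite S \<and> card S = t \<and> indep G S"
    using 1 2 3 f(2) by (intro bexI[of _ "f 0"] exI[of _ S]) (auto simp: S_def)
next
  assume "\<exists>v\<in>verts G. \<exists>S \<subseteq> nbrs G v. finite S \<and> card S = t \<and> indep G S"
  then obtain v S where v: "v \<in> verts G" "S \<subseteq> nbrs G v" "finite S" "card S = t" "indep G S" by blast
  obtain g where g: "bij_betw g {1..t} S"
    using v finite_same_card_bij[of "{1..t}" S] by auto
  \<comment> \<open>The centre of \<open>star t\<close> is 0, so \<open>v\<close> goes there; the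
    vertices in \<open>S\<close> are numbered from 1 on.\<close>
  define f where "f = g(0 := v)"
  have vS: "v \<notin> S" using v(2) nbrs_subset[OF assms] by blast
  have f0: "f 0 = v" and fS: "f ` {1..t} = S" using g by (auto simp: f_def bij_betw_def)
  have "{0..t} = insert 0 {1..t}" by auto
  then have fV: "f ` {0..t} = insert v S" using f0 fS by simp
  have "(\<lambda>e. f ` e) ` edges (star t) = (\<lambda>w. {v, w}) ` S"
    unfolding fS[symmetric] edges_star by (simp add: image_image f0)
  also have "\<dots> = {e \<in> edges G. e \<subseteq> insert v S}"
  proof safe
    fix w assume "w \<in> S"
    then show "{v, w} \<in> edges G" using v(2) by (auto simp: nbrs_def)
  next
    fix e assume e: "e \<in> edges G" "e \<subseteq> insert v S"
    then obtain x y where xy: "e = {x, y}" "x \<noteq> y"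
      using assms by (auto simp: simple_graph_def card_2_iff)
    then have "x = v \<or> y = v" using e v(5) by (auto simp: indep_def)
    then show "e \<in> (\<lambda>w. {v, w}) ` S" using xy e by auto
  qed
  finally show "has_induced_subgraph G (star t)"
    unfolding has_induced_subgraph_iff_embedding[OF simple_graph_star]
    using inj_on_star_insert[OF vS g, folded f_def] v(1,2) fV nbrs_subset[OF assms, of v]
    by (intro exI[of _ f]) (auto simp: star_def)
qed

lemma edges_cycle: "edges (cycle k) = (\<lambda>i. {i, (i + 1) mod k}) ` {..<k}"
  by (auto simp: cycle_def)

lemma has_cycle_iff:
  assumes "k \<ge> 3"
  shows "has_subgraph G (cycle k) \<longleftrightarrow>
    (\<exists>f. inj_on f {..<k} \<and> f ` {..<k} \<subseteq> verts G \<and> (\<forall>i<k. {f i, f ((i + 1) mod k)} \<in> edges G))"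
proof -
  have *: "(\<forall>e\<in>edges (cycle k). f ` e \<in> edges G) \<longleftrightarrow> (\<forall>i<k. {f i, f ((i + 1) mod k)} \<in> edges G)" for f
    unfolding edges_cycle ball_simps image_insert image_empty by (simp add: Ball_def)
  show ?thesis
    unfolding has_subgraph_iff_embedding[OF simple_graph_cycle[OF assms]] * by (simp add: cycle_def)
qed

text \<open>Handshake lemma: incident pairs of a vertex and an edge are counted in both
  ways.\<close>

lemma sum_degrees:
  assumes "simple_graph G"
  shows "(\<Sum>v\<in>verts G. card (nbrs G v)) = 2 * card (edges G)"
proof -
  have finE: "finite (edges G)"
    using assms by (auto simp: simple_graph_def intro: finite_subset[of _ "Pow (verts G)"])
  have finV: "finite (verts G)" using assms by (simp add: simple_graph_def)
  have "card (nbrs G v) = card {e \<in> edges G. v \<in> e}" for v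
  proof (rule bij_betw_same_card)
    show "bij_betw (\<lambda>w. {v, w}) (nbrs G v) {e \<in> edges G. v \<in> e}"
    proof (rule bij_betw_imageI)
      show "inj_on (\<lambda>w. {v, w}) (nbrs G v)" by (auto simp: inj_on_def doubleton_eq_iff)
      show "(\<lambda>w. {v, w}) ` nbrs G v = {e \<in> edges G. v \<in> e}"
      proof safe
        fix e assume e: "e \<in> edges G" "v \<in> e"
        then obtain x y where "e = {x, y}" using assms by (auto simp: simple_graph_def card_2_iff)
        with e have "\<exists>w. e = {v, w}" by auto
        then show "e \<in> (\<lambda>w. {v, w}) ` nbrs G v" using e by (auto simp: nbrs_def)
      qed (auto simp: nbrs_def)
    qed
  qed
  then have "(\<Sum>v\<in>verts G. card (nbrs G v)) = (\<Sum>v\<in>verts G. card {e \<in> edges G. v \<in> e})" by simp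
  also have "\<dots> = (\<Sum>e\<in>edges G. card {v \<in> verts G. v \<in> e})"
    using sum.swap_restrict[OF finV finE, of "\<lambda>_ _. 1::nat" "\<lambda>v e. v \<in> e"] by simp
  also have "\<dots> = (\<Sum>e\<in>edges G. 2)"
  proof (rule sum.cong)
    fix e assume "e \<in> edges G"
    then have "{v \<in> verts G. v \<in> e} = e" "card e = 2" using assms by (auto simp: simple_graph_def)
    then show "card {v \<in> verts G. v \<in> e} = 2" by simp
  qed simp
  finally show ?thesis by simp
qed

section \<open>The upper bound\<close>

text \<open>In an independent subset of \<open>U\<close> that is maximal under inclusion, a vertex
  without a neighbour could still be added.\<close>

lemma exists_dominating_indep:
  assumes "simple_graph G" "finite U"
  obtains I where "I \<subseteq> U" "indep G I" "\<And>v. v \<in> U - I \<Longrightarrow> \<exists>w\<in>I. {v, w} \<in> edges G"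
proof -
  have loop: "{x} \<notin> edges G" for x using simple_graph_edge(3)[OF assms(1), of x x] by auto
  define A where "A = {I. I \<subseteq> U \<and> indep G I}"
  have "finite A" "{} \<in> A" using assms(2) by (auto simp: A_def indep_def)
  then obtain I where "I \<in> A" and max: "\<And>J. J \<in> A \<Longrightarrow> I \<subseteq> J \<Longrightarrow> I = J"
    using finite_has_maximal2[of A "{}"] by metis
  then have I: "I \<subseteq> U" "indep G I" by (auto simp: A_def)
  have "\<exists>w\<in>I. {v, w} \<in> edges G" if v: "v \<in> U - I" for v
  proof (rule ccontr)
    assume "\<not> (\<exists>w\<in>I. {v, w} \<in> edges G)"
    then have "indep G (insert v I)" using I loop by (auto simp: indep_def insert_commute)
    then show False using max[of "insert v I"] I v by (auto simp: A_def)
  qed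
  with I that show thesis by blast
qed

text \<open>Peeling off a maximal independent set lengthens by one the paths that start in the
  remaining set.\<close>

lemma long_paths_after_peeling:
  assumes "simple_graph G" "finite S"
    and small: "\<And>I. I \<subseteq> S \<Longrightarrow> indep G I \<Longrightarrow> card I \<le> a"
  shows "\<exists>U \<subseteq> S. card (S - U) \<le> m * a \<and>
    (\<forall>v\<in>U. \<exists>xs. length xs = m \<and> distinct xs \<and> set xs \<subseteq> S - U \<and>
      (\<forall>i<m. {(v # xs) ! i, xs ! i} \<in> edges G))"
proof (induction m)
  \<comment> \<open>For \<open>i < m\<close>, the pairs \<open>{(v # xs) ! i, xs ! i}\<close> are
    the consecutive ones of the path \<open>v # xs\<close>.\<close>
  case 0
  show ?case by (intro exI[of _ S]) auto
next
  case (Suc m)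
  then obtain U where U: "U \<subseteq> S" "card (S - U) \<le> m * a"
    and path: "\<And>v. v \<in> U \<Longrightarrow> \<exists>xs. length xs = m \<and> distinct xs \<and> set xs \<subseteq> S - U \<and>
      (\<forall>i<m. {(v # xs) ! i, xs ! i} \<in> edges G)"
    by blast
  obtain I where I: "I \<subseteq> U" "indep G I" "\<And>v. v \<in> U - I \<Longrightarrow> \<exists>w\<in>I. {v, w} \<in> edges G"
    using exists_dominating_indep[OF assms(1)] finite_subset[OF U(1) assms(2)] by metis
  have "card (S - (U - I)) = card ((S - U) \<union> I)" using I U by (intro arg_cong[of _ _ card]) auto
  also have "\<dots> \<le> card (S - U) + card I" by (rule card_Un_le)
  also have "\<dots> \<le> Suc m * a" using U(2) small[of I] I(1,2) U(1) by (simp add: add_mono subset_trans)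
  finally have "card (S - (U - I)) \<le> Suc m * a" .
  moreover have "\<exists>xs. length xs = Suc m \<and> distinct xs \<and> set xs \<subseteq> S - (U - I) \<and>
      (\<forall>i<Suc m. {(v # xs) ! i, xs ! i} \<in> edges G)" if v: "v \<in> U - I" for v
  proof -
    obtain w where w: "w \<in> I" "{v, w} \<in> edges G" using I(3)[OF v] by blast
    then obtain xs where xs: "length xs = m" "distinct xs" "set xs \<subseteq> S - U"
        "\<forall>i<m. {(w # xs) ! i, xs ! i} \<in> edges G"
      using path[of w] I(1) by blast
    \<comment> \<open>\<open>w\<close> lies in \<open>I\<close>, hence in \<open>U\<close>, so it is
      new to \<open>xs\<close>, which stays in \<open>S - U\<close>.\<close>
    then show ?thesis using w I U
      by (intro exI[of _ "w # xs"]) (auto simp: less_Suc_eq_0_disj)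
  qed
  ultimately show ?case using U(1) by (intro exI[of _ "U - I"]) blast
qed

text \<open>A vertex left after \<open>k - 2\<close> rounds would begin a path on
  \<open>k - 1\<close> neighbours of \<open>v\<close>, and \<open>v\<close> closes this path to a
  cycle of length \<open>k\<close>.\<close>

lemma degree_le:
  assumes G: "simple_graph G" and k: "k \<ge> 3" and t: "t \<ge> 1" and v: "v \<in> verts G"
    and no_cycle: "\<not> has_subgraph G (cycle k)" and no_star: "\<not> has_induced_subgraph G (star t)"
  shows "card (nbrs G v) \<le> (k - 2) * (t - 1)"
proof -
  define S where "S = nbrs G v"
  have fin: "finite S"
    using G nbrs_subset[OF G, of v] unfolding S_def simple_graph_def
    by (metis finite_Diff finite_subset)
  have "card I \<le> t - 1" if I: "I \<subseteq> S" "indep G I" for I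
  proof (rule ccontr)
    assume "\<not> card I \<le> t - 1"
    then obtain J where J: "J \<subseteq> I" "card J = t" "finite J"
      using obtain_subset_with_card_n[of t I] by (metis Suc_pred' not_less_eq_eq t less_eq_Suc_le One_nat_def not_le)
    then have "indep G J" using I by (auto simp: indep_def)
    then show False
      using J I no_star v unfolding has_induced_star_iff[OF G] S_def by blast
  qed
  then obtain U where U: "U \<subseteq> S" "card (S - U) \<le> (k - 2) * (t - 1)"
    and path: "\<And>w. w \<in> U \<Longrightarrow> \<exists>xs. length xs = k - 2 \<and> distinct xs \<and> set xs \<subseteq> S - U \<and>
      (\<forall>i<k - 2. {(w # xs) ! i, xs ! i} \<in> edges G)"
    using long_paths_after_peeling[OF G fin, of "t - 1" "k - 2"] by blast
  have "U = {}"
  proof (rule ccontr)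
    assume "U \<noteq> {}"
    then obtain w where "w \<in> U" by blast
    then obtain xs where xs: "length xs = k - 2" "distinct xs" "set xs \<subseteq> S - U"
        "\<forall>i<k - 2. {(w # xs) ! i, xs ! i} \<in> edges G"
      using path by blast
    define ys where "ys = w # xs"
    have ys: "length ys = k - 1" "distinct ys" "set ys \<subseteq> S"
      using xs \<open>w \<in> U\<close> U k by (auto simp: ys_def)
    have adj: "{ys ! i, ys ! Suc i} \<in> edges G" if "i < k - 2" for i
      using xs(4) that by (auto simp: ys_def)
    have vys: "v \<notin> set ys" using ys(3) nbrs_subset[OF G] by (auto simp: S_def)
    define f where "f i = (v # ys) ! i" for i
    have "inj_on f {..<k}"
      using ys vys k unfolding f_def inj_on_def by (auto simp: nth_eq_iff_index_eq nth_Cons')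
    moreover have "f ` {..<k} \<subseteq> verts G"
    proof -
      have "f i \<in> set (v # ys)" if "i < k" for i
        unfolding f_def by (rule nth_mem) (use that ys k in auto)
      then show ?thesis using v ys(3) nbrs_subset[OF G, of v] unfolding S_def by fastforce
    qed
    moreover have "{f i, f ((i + 1) mod k)} \<in> edges G" if "i < k" for i
    proof -
      have vy: "{v, ys ! j} \<in> edges G" if "j < k - 1" for j
        using that ys by (metis S_def mem_Collect_eq nbrs_def nth_mem subsetD)
      \<comment> \<open>With \<open>v\<close> at position 0, the edges number 0 and
        \<open>k - 1\<close> are those at \<open>v\<close>; all others belong to the path.\<close>
      consider "i = 0" | "i = k - 1" | j where "i = Suc j" "j < k - 2"
        using \<open>i < k\<close> by (cases i) fastforce+
      then show ?thesis
      proof cases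
        case 1 then show ?thesis using vy[of 0] k by (simp add: f_def)
      next
        case 2
        then have "f i = ys ! (k - 2)" using k by (simp add: f_def nth_Cons' numeral_2_eq_2)
        moreover have "(i + 1) mod k = 0" using 2 k by simp
        ultimately show ?thesis using vy[of "k - 2"] k by (simp add: f_def insert_commute)
      next
        case 3
        then have "(i + 1) mod k = Suc (Suc j)" by simp
        then show ?thesis using adj[OF 3(2)] 3(1) by (simp add: f_def)
      qed
    qed
    ultimately show False using no_cycle unfolding has_cycle_iff[OF k] by blast
  qed
  with U show ?thesis by (simp add: S_def)
qed

lemma ex_ind_upper:
  assumes "k \<ge> 3" "t \<ge> 3"
  shows "2 * ex_ind n (cycle k) (star t) \<le> (k - 2) * (t - 1) * n"
proof -
  have "2 * card (edges F) \<le> (k - 2) * (t - 1) * n" if "F \<in> admissible n (cycle k) (star t)" for F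
  proof -
    have F: "simple_graph F" "card (verts F) = n" "\<not> has_subgraph F (cycle k)"
        "\<not> has_induced_subgraph F (star t)"
      using that by (auto simp: admissible_def)
    have "2 * card (edges F) = (\<Sum>v\<in>verts F. card (nbrs F v))" using sum_degrees[OF F(1)] by simp
    also have "\<dots> \<le> (\<Sum>v\<in>verts F. (k - 2) * (t - 1))"
      using degree_le[OF F(1)] F assms by (intro sum_mono) auto
    finally show ?thesis using F(2) by (simp add: mult.commute)
  qed
  \<comment> \<open>Nonemptiness makes the maximum an attained value, so the bound for each graph
    passes to it.\<close>
  moreover have "ex_ind n (cycle k) (star t) \<in> (\<lambda>F. card (edges F)) ` admissible n (cycle k) (star t)"
    unfolding ex_ind_def
    by (intro Max_in finite_edge_counts) (simp add: admissible_nonempty[OF assms])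
  ultimately show ?thesis by auto
qed

section \<open>Graphs on other vertex types\<close>

text \<open>\<open>admissible\<close> speaks of graphs on \<open>nat\<close>, whereas the extremal
  graph has permutations as vertices; an injection into \<open>nat\<close> carries it over.\<close>

lemma admissible_relabel:
  fixes G :: "'v graph"
  assumes G: "simple_graph G" and "k \<ge> 3"
    and "\<not> has_subgraph G (cycle k)" "\<not> has_induced_subgraph G (star t)"
  shows "\<exists>F \<in> admissible (card (verts G)) (cycle k) (star t). card (edges F) = card (edges G)"
proof -
  have fin: "finite (verts G)" using G by (simp add: simple_graph_def)
  obtain h :: "'v \<Rightarrow> nat" where h: "inj_on h (verts G)"
    using finite_imp_inj_to_nat_seg[OF fin] by blast
  define F where "F = (h ` verts G, (\<lambda>e. h ` e) ` edges G)"
  define g where "g = the_inv_into (verts G) h"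
  have gh: "g (h x) = x" if "x \<in> verts G" for x
    using that h by (simp add: g_def the_inv_into_f_f)
  have sub: "e \<subseteq> verts G" if "e \<in> edges G" for e using that G by (auto simp: simple_graph_def)
  have injE: "inj_on (\<lambda>e. h ` e) (edges G)"
    using sub h by (meson inj_on_image_eq_iff inj_onI)
  have F: "simple_graph F"
    using G h unfolding simple_graph_def F_def by (auto simp: card_image inj_on_subset)
  have edge: "{x, y} \<in> edges F \<longleftrightarrow> {g x, g y} \<in> edges G" if xy: "x \<in> verts F" "y \<in> verts F" for x y
  proof -
    obtain a b where ab: "x = h a" "y = h b" "a \<in> verts G" "b \<in> verts G"
      using xy by (auto simp: F_def)
    have "e = {a, b}" if "e \<in> edges G" "h ` e = h ` {a, b}" for e
      using that sub[of e] ab h by (subst (asm) inj_on_image_eq_iff) auto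
    then have "h ` {a, b} \<in> (\<lambda>e. h ` e) ` edges G \<longleftrightarrow> {a, b} \<in> edges G" by auto
    then show ?thesis using ab gh by (simp add: F_def)
  qed
  have g: "inj_on g (verts F)" "g ` verts F = verts G" using gh by (force simp: F_def inj_on_def)+
  have "\<not> has_subgraph F (cycle k)"
  proof
    assume "has_subgraph F (cycle k)"
    then obtain f where f: "inj_on f {..<k}" "f ` {..<k} \<subseteq> verts F"
        "\<forall>i<k. {f i, f ((i + 1) mod k)} \<in> edges F"
      unfolding has_cycle_iff[OF \<open>k \<ge> 3\<close>] by blast
    have "inj_on (g \<circ> f) {..<k}" using f g by (meson comp_inj_on inj_on_subset)
    moreover have "(g \<circ> f) ` {..<k} \<subseteq> verts G" using f(2) g(2) by auto
    moreover have "\<forall>i<k. {(g \<circ> f) i, (g \<circ> f) ((i + 1) mod k)} \<in> edges G"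
      using f(3) edge simple_graph_edge[OF F] by (metis comp_apply)
    ultimately show False
      using assms(3) unfolding has_cycle_iff[OF \<open>k \<ge> 3\<close>] by blast
  qed
  moreover have "\<not> has_induced_subgraph F (star t)"
  proof
    assume "has_induced_subgraph F (star t)"
    then obtain v S where v: "v \<in> verts F" "S \<subseteq> nbrs F v" "finite S" "card S = t" "indep F S"
      unfolding has_induced_star_iff[OF F] by blast
    have S: "S \<subseteq> verts F" using v(2) nbrs_subset[OF F] by blast
    have "g v \<in> verts G" using v(1) g(2) by auto
    moreover have "g ` S \<subseteq> nbrs G (g v)"
    proof clarify
      fix w assume "w \<in> S"
      then have "{v, w} \<in> edges F" using v(2) by (auto simp: nbrs_def)
      then show "g w \<in> nbrs G (g v)"
        using edge[of v w] simple_graph_edge(1,2)[OF F] by (simp add: nbrs_def)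
    qed
    moreover have "card (g ` S) = t" using v(4) g(1) S by (simp add: card_image inj_on_subset)
    moreover have "indep G (g ` S)" using v(5) edge S unfolding indep_def by blast
    ultimately show False
      using assms(4) v(3) unfolding has_induced_star_iff[OF G] by blast
  qed
  moreover have "card (verts F) = card (verts G)" "card (edges F) = card (edges G)"
    using h injE by (simp_all add: F_def card_image)
  ultimately show ?thesis using F unfolding admissible_def by blast
qed

section \<open>Reduced words of a free product of cyclic groups\<close>

text \<open>A word lists its syllables: the letter \<open>(i, e)\<close> stands for the \<open>e\<close>-th power of a generator of
  the \<open>i\<close>-th of \<open>r\<close> cyclic groups of order \<open>q\<close>.\<close>

definition reduced :: "nat \<Rightarrow> nat \<Rightarrow> nat \<Rightarrow> (nat \<times> nat) list set" where
  "reduced r q L = {w. length w \<le> L \<and> set w \<subseteq> {..<r} \<times> {0<..<q} \<and>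
    successively (\<lambda>x y. fst x \<noteq> fst y) w}"

lemma finite_reduced: "finite (reduced r q L)"
  by (rule finite_subset[OF _ finite_lists_length_le[of "{..<r} \<times> {0<..<q}" L]])
    (auto simp: reduced_def)

definition strip :: "nat \<Rightarrow> (nat \<times> nat) list \<Rightarrow> (nat \<times> nat) list" where
  "strip i w = (if w \<noteq> [] \<and> fst (hd w) = i then tl w else w)"

text \<open>Exponent 0 stands for an absent syllable, so that \<open>strip\<close> and
  \<open>expo\<close> split every reduced word into a power of generator \<open>i\<close> and a
  rest.\<close>

definition expo :: "nat \<Rightarrow> (nat \<times> nat) list \<Rightarrow> nat" where
  "expo i w = (if w \<noteq> [] \<and> fst (hd w) = i then snd (hd w) else 0)"

definition prepend :: "nat \<Rightarrow> nat \<Rightarrow> nat \<Rightarrow> (nat \<times> nat) list \<Rightarrow> (nat \<times> nat) list" where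
  "prepend q i e w = (if e mod q = 0 then w else (i, e mod q) # w)"

text \<open>Left multiplication by the \<open>e\<close>-th power of the \<open>i\<close>-th generator, except that the words of
  length \<open>L\<close> not starting with a power of this generator are fixed: this turns the action of each
  cyclic factor on all words into an action on the finite set of words of length at most \<open>L\<close>.\<close>

definition act :: "nat \<Rightarrow> nat \<Rightarrow> nat \<Rightarrow> nat \<Rightarrow> nat \<Rightarrow> (nat \<times> nat) list \<Rightarrow> (nat \<times> nat) list" where
  "act r q L i e w = (if w \<in> reduced r q L \<and> length (strip i w) < L
     then prepend q i (e + expo i w) (strip i w) else w)"

text \<open>Neighbouring syllables of a reduced word come from different factors. The equation
  \<open>strip i w = w\<close> serves below to say that \<open>w\<close> does not begin with a
  syllable of factor \<open>i\<close>.\<close>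

lemma strip_strip:
  assumes "w \<in> reduced r q L"
  shows "strip i (strip i w) = strip i w"
  using assms by (cases w; cases "tl w") (auto simp: reduced_def strip_def)

lemma expo_eq_0: "strip i w = w \<Longrightarrow> expo i w = 0"
  by (cases w) (auto simp: strip_def expo_def)

lemma strip_reduced: "w \<in> reduced r q L \<Longrightarrow> strip i w \<in> reduced r q L"
  by (cases w) (auto simp: reduced_def strip_def successively_Cons)

lemma prepend_reduced:
  assumes "w \<in> reduced r q L" "length w < L" "strip i w = w" "i < r" "q > 0"
  shows "prepend q i e w \<in> reduced r q L"
  using assms by (cases w) (auto simp: reduced_def prepend_def strip_def successively_Cons)

lemma strip_prepend: "strip i w = w \<Longrightarrow> strip i (prepend q i e w) = w"
  by (cases w) (auto simp: strip_def prepend_def split: if_splits)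

lemma expo_prepend: "strip i w = w \<Longrightarrow> expo i (prepend q i e w) = e mod q"
  by (cases "e mod q = 0") (simp_all add: prepend_def expo_eq_0, simp add: expo_def)

lemma prepend_expo_strip:
  assumes "w \<in> reduced r q L"
  shows "prepend q i (expo i w) (strip i w) = w"
  using assms by (cases w) (auto simp: reduced_def prepend_def strip_def expo_def)

lemma prepend_cong_mod: "e mod q = f mod q \<Longrightarrow> prepend q i e w = prepend q i f w"
  by (simp add: prepend_def)

section \<open>The action of one cyclic factor\<close>

lemma act_cong_mod:
  assumes "e mod q = f mod q"
  shows "act r q L i e = act r q L i f"
proof
  fix w
  have "(e + expo i w) mod q = (f + expo i w) mod q" using assms by (rule mod_add_cong) simp
  from prepend_cong_mod[OF this] show "act r q L i e w = act r q L i f w" by (simp add: act_def)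
qed

lemma act_0: "act r q L i 0 = id"
  using prepend_expo_strip by (force simp: act_def)

lemma act_mult: "act r q L i (q * e) = id"
  using act_cong_mod[of "q * e" q 0] by (simp add: act_0)

text \<open>The action leaves \<open>strip i w\<close> unchanged, so the condition in
  \<open>act\<close> holds before and after, and the exponents add modulo \<open>q\<close>.\<close>

lemma act_act:
  assumes "i < r" "q > 0"
  shows "act r q L i e \<circ> act r q L i f = act r q L i (e + f)"
proof
  fix w
  show "(act r q L i e \<circ> act r q L i f) w = act r q L i (e + f) w"
  proof (cases "w \<in> reduced r q L \<and> length (strip i w) < L")
    case True
    define u where "u = strip i w"
    have u: "u \<in> reduced r q L" "length u < L" "strip i u = u"
      using True strip_reduced strip_strip by (auto simp: u_def)
    define w' where "w' = prepend q i (f + expo i w) u"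
    have w': "w' \<in> reduced r q L" "strip i w' = u" "expo i w' = (f + expo i w) mod q"
      using u assms by (auto simp: w'_def prepend_reduced strip_prepend expo_prepend)
    have "act r q L i e w' = prepend q i (e + (f + expo i w) mod q) u"
      using w' u by (simp add: act_def)
    also have "\<dots> = prepend q i (e + f + expo i w) u"
      by (rule prepend_cong_mod) (simp add: mod_add_right_eq add.assoc)
    finally show ?thesis using True by (simp add: act_def[of _ _ _ _ f] act_def[of _ _ _ _ "e + f"] w'_def u_def)
  qed (auto simp: act_def)
qed

text \<open>This growth by one letter is what separates powers of generators and keeps short cycles
  from closing up.\<close>

lemma act_reduced_cons:
  assumes "w \<in> reduced r q L" "strip i w = w" "length w < L" "e mod q \<noteq> 0"
  shows "act r q L i e w = (i, e mod q) # w"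
  using assms by (simp add: act_def expo_eq_0 prepend_def)

lemma Nil_reduced: "[] \<in> reduced r q L"
  by (simp add: reduced_def)

lemma strip_Nil: "strip i [] = []"
  by (simp add: strip_def)

section \<open>A regular graph of large girth glued from cliques\<close>

text \<open>\<open>r\<close> counts the cliques through a vertex and \<open>q\<close> is their size.
  With \<open>L > 0\<close> there is room for a generator to move the empty word.\<close>

locale clique_graph =
  fixes r q L :: nat and S :: "(nat \<times> nat) list set"
  assumes q_pos: "q > 0" and L_pos: "L > 0" and finite_S: "finite S" and reduced_S: "reduced r q L \<subseteq> S"
begin

abbreviation gen :: "nat \<Rightarrow> nat \<Rightarrow> (nat \<times> nat) list \<Rightarrow> (nat \<times> nat) list" where
  "gen \<equiv> act r q L"

definition V :: "((nat \<times> nat) list \<Rightarrow> (nat \<times> nat) list) set" where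
  "V = {p. p permutes S}"

text \<open>On \<open>V\<close> this is the Cayley graph of the symmetric group on \<open>S\<close>
  with respect to the nontrivial powers of the \<open>r\<close> generators.\<close>

definition adj :: "((nat \<times> nat) list \<Rightarrow> (nat \<times> nat) list) \<Rightarrow> ((nat \<times> nat) list \<Rightarrow> (nat \<times> nat) list) \<Rightarrow> bool" where
  "adj u v \<longleftrightarrow> u \<noteq> v \<and> (\<exists>i<r. \<exists>e. v = gen i e \<circ> u)"

definition \<Gamma> :: "((nat \<times> nat) list \<Rightarrow> (nat \<times> nat) list) graph" where
  "\<Gamma> = (V, {{u, v} | u v. u \<in> V \<and> v \<in> V \<and> adj u v})"

lemma gen_permutes:
  assumes "i < r"
  shows "gen i e permutes S"
proof -
  \<comment> \<open>Exponents are natural numbers, so \<open>(q - 1) * e\<close> plays the part of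
    the inverse exponent.\<close>
  have "(q - 1) * e + e = q * e" "e + (q - 1) * e = q * e"
    using q_pos by (cases q; simp)+
  then have "gen i ((q - 1) * e) \<circ> gen i e = id" "gen i e \<circ> gen i ((q - 1) * e) = id"
    using act_act[OF assms q_pos] act_mult by metis+
  then have "bij (gen i e)" using o_bij by blast
  moreover have "gen i e w = w" if "w \<notin> S" for w using that reduced_S by (auto simp: act_def)
  ultimately show ?thesis unfolding permutes_def bij_iff by blast
qed

lemma gen_coset:
  assumes "i < r" "v = gen i e \<circ> u" "v' = gen i f \<circ> u"
  shows "v' = gen i (f + (q - 1) * e) \<circ> v"
proof -
  have "f + (q - 1) * e + e = f + q * e" using q_pos by (cases q) simp_all
  moreover have "gen i (f + q * e) = gen i f" by (rule act_cong_mod) simp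
  ultimately show ?thesis
    using act_act[OF assms(1) q_pos, of L "f + (q - 1) * e" e] assms(2,3) by (metis o_assoc)
qed

lemma gen_0: "gen i 0 \<circ> u = u"
  by (simp add: act_0)

text \<open>Each coset of a cyclic factor is a clique.\<close>

lemma adj_coset:
  assumes "i < r" "v = gen i e \<circ> u" "v' = gen i f \<circ> u" "v \<noteq> v'"
  shows "adj v v'"
  using gen_coset[OF assms(1-3)] assms(1,4) unfolding adj_def by blast

lemma adj_sym:
  assumes "adj u v"
  shows "adj v u"
proof -
  obtain i e where "i < r" "v = gen i e \<circ> u" "u \<noteq> v" using assms unfolding adj_def by blast
  then show ?thesis using adj_coset[of i v e u u 0] gen_0[of i u] by auto
qed

lemma verts: "verts \<Gamma> = V"
  by (simp add: \<Gamma>_def)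

lemma edge_iff: "{u, v} \<in> edges \<Gamma> \<longleftrightarrow> u \<in> V \<and> v \<in> V \<and> adj u v"
  using adj_sym unfolding \<Gamma>_def by (auto simp: doubleton_eq_iff)

lemma simple_graph: "simple_graph \<Gamma>"
proof -
  have "finite V" using finite_permutations[OF finite_S] by (simp add: V_def)
  moreover have "card {u, v} = 2" if "adj u v" for u v using that by (simp add: adj_def)
  ultimately show ?thesis unfolding simple_graph_def \<Gamma>_def by auto
qed

lemma gen_V: "i < r \<Longrightarrow> u \<in> V \<Longrightarrow> gen i e \<circ> u \<in> V"
  using gen_permutes permutes_compose unfolding V_def by blast

lemma gen_cancel:
  assumes "u \<in> V" "gen i e \<circ> u = gen j f \<circ> u"
  shows "gen i e = gen j f"
proof
  fix w
  have "surj u" using assms(1) permutes_surj unfolding V_def by blast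
  then obtain x where "w = u x" by (metis surjD)
  then show "gen i e w = gen j f w" using fun_cong[OF assms(2), of x] by simp
qed

text \<open>The image of the empty word is a single letter, which reveals both the factor and the
  exponent.\<close>

lemma gen_inj:
  assumes "gen i e = gen j f" "0 < e" "e < q" "0 < f" "f < q"
  shows "i = j \<and> e = f"
proof -
  have "gen i e [] = [(i, e)]" "gen j f [] = [(j, f)]"
    using assms(2-5) L_pos by (simp_all add: act_reduced_cons Nil_reduced strip_Nil)
  then have "[(i, e)] = [(j, f)]" using assms(1) by metis
  then show ?thesis by simp
qed

lemma degree:
  assumes "u \<in> V"
  shows "card (nbrs \<Gamma> u) = r * (q - 1)"
proof -
  define h where "h = (\<lambda>(i, e). gen i e \<circ> u)"
  have "inj_on h ({..<r} \<times> {0<..<q})"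
    using gen_cancel[OF assms] gen_inj unfolding h_def inj_on_def by fastforce
  moreover have "nbrs \<Gamma> u = h ` ({..<r} \<times> {0<..<q})"
  proof (intro equalityI subsetI)
    fix v assume "v \<in> nbrs \<Gamma> u"
    then obtain i e where v: "u \<noteq> v" "i < r" "v = gen i e \<circ> u"
      unfolding nbrs_def edge_iff adj_def by blast
    have e: "gen i e = gen i (e mod q)" by (rule act_cong_mod) simp
    then have "e mod q \<noteq> 0" using v gen_0[of i u] by metis
    then have "(i, e mod q) \<in> {..<r} \<times> {0<..<q}" using v q_pos by simp
    moreover have "v = h (i, e mod q)" using v e by (simp add: h_def)
    ultimately show "v \<in> h ` ({..<r} \<times> {0<..<q})" by blast
  next
    fix v assume "v \<in> h ` ({..<r} \<times> {0<..<q})"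
    then obtain i e where v: "i < r" "0 < e" "e < q" "v = gen i e \<circ> u" by (auto simp: h_def)
    have "u \<noteq> v"
    proof
      assume "u = v"
      then have "gen i e = gen i 0" using gen_cancel[OF assms] v(4) gen_0 by metis
      then have "gen i e [] = []" by (simp add: act_0)
      then show False using v L_pos by (simp add: act_reduced_cons Nil_reduced strip_Nil)
    qed
    then show "v \<in> nbrs \<Gamma> u" using v assms gen_V unfolding nbrs_def edge_iff adj_def by blast
  qed
  ultimately show ?thesis by (simp add: card_image card_cartesian_product)
qed

text \<open>The neighbours of \<open>u\<close> lie in \<open>r\<close> cosets, so among more than
  \<open>r\<close> of them two share a coset and are adjacent.\<close>

lemma no_induced_star:
  assumes "r < t"
  shows "\<not> has_induced_subgraph \<Gamma> (star t)"
proof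
  assume "has_induced_subgraph \<Gamma> (star t)"
  then obtain u A where A: "A \<subseteq> nbrs \<Gamma> u" "finite A" "card A = t" "indep \<Gamma> A"
    unfolding has_induced_star_iff[OF simple_graph] by blast
  have "\<forall>v\<in>A. \<exists>i<r. \<exists>e. v = gen i e \<circ> u"
    using A(1) unfolding nbrs_def edge_iff adj_def by blast
  then obtain c where c: "\<forall>v\<in>A. c v < r \<and> (\<exists>e. v = gen (c v) e \<circ> u)" by metis
  have "\<not> inj_on c A"
  proof (rule pigeonhole)
    have "card (c ` A) \<le> card {..<r}" using c by (intro card_mono) auto
    then show "card (c ` A) < card A" using A(3) assms by simp
  qed
  then obtain v v' where v: "v \<in> A" "v' \<in> A" "v \<noteq> v'" "c v = c v'" unfolding inj_on_def by blast
  then have "adj v v'" using c adj_coset by metis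
  moreover have "v \<in> V" "v' \<in> V" using v A(1) unfolding nbrs_def edge_iff by blast+
  ultimately show False using A(4) v unfolding indep_def edge_iff by blast
qed

text \<open>Along a cycle, apply the vertices to a preimage of the empty word under the first vertex.
  Each maximal run of edges from one cyclic factor adds a syllable, so no cycle of length at
  most \<open>L\<close> closes up unless it consists of a single run, in which case it lies in a clique of size
  \<open>q\<close>.\<close>

lemma no_cycle:
  assumes k: "k \<ge> 3" "q < k" "k \<le> L"
  shows "\<not> has_subgraph \<Gamma> (cycle k)"
proof
  assume "has_subgraph \<Gamma> (cycle k)"
  then obtain f where f: "inj_on f {..<k}" "f ` {..<k} \<subseteq> V"
      "\<And>i. i < k \<Longrightarrow> {f i, f ((i + 1) mod k)} \<in> edges \<Gamma>"
    unfolding has_cycle_iff[OF k(1)] by (auto simp: \<Gamma>_def)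
  \<comment> \<open>Periodic indexing makes \<open>g k\<close> the return to
    \<open>g 0\<close>.\<close>
  define g where "g j = f (j mod k)" for j
  have adj_g: "adj (g j) (g (Suc j))" for j
    using f(3)[of "j mod k"] k(1) unfolding edge_iff g_def by (simp add: mod_Suc_eq)
  \<comment> \<open>The last condition rules out \<open>s = 0\<close> with \<open>j = k\<close>, the
    one pair at which the closed walk repeats a vertex.\<close>
  have g_neq: "g s \<noteq> g j" if "s < j" "j \<le> k" "s > 0 \<or> j < k" for s j
  proof -
    have "s mod k \<noteq> j mod k" using that by (cases "j = k") auto
    then show ?thesis using inj_onD[OF f(1), of "s mod k" "j mod k"] k(1) unfolding g_def by auto
  qed
  have "f 0 \<in> V" using f(2) k(1) by force
  then have "g 0 permutes S" using k(1) by (simp add: g_def V_def)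
  then obtain x where x: "g 0 x = []" using permutes_surj by (metis surjD)
  define w where "w j = g j x" for j
  \<comment> \<open>The vertices from \<open>s\<close> to \<open>j\<close> lie in one coset of
    factor \<open>i\<close>, and \<open>w s\<close> does not begin with a syllable of that factor.
    The bound \<open>s\<close> on the length of \<open>w s\<close> keeps it below \<open>L\<close>,
    as \<open>s < j\<close> and \<open>j\<close> is at most \<open>k\<close>.\<close>
  define run where "run s j i \<longleftrightarrow> s < j \<and> i < r \<and> w s \<in> reduced r q L \<and> length (w s) \<le> s \<and>
    strip i (w s) = w s \<and> (\<forall>l\<in>{s..j}. \<exists>e. g l = gen i e \<circ> g s)" for s j i
  \<comment> \<open>The two ends of the run are distinct vertices, so they differ by a nontrivial
    power, which adds one letter.\<close>
  have run_end: "\<exists>e. w j = (i, e) # w s \<and> w j \<in> reduced r q L"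
    if prems: "run s j i" "j \<le> k" "s > 0 \<or> j < k" for s j i
  proof -
    have "j \<in> {s..j}" using prems(1) by (simp add: run_def)
    then obtain e where e: "g j = gen i e \<circ> g s" using prems(1) unfolding run_def by blast
    have "gen i e = id" if "e mod q = 0" using act_cong_mod[of e q 0] that by (simp add: act_0)
    then have "e mod q \<noteq> 0" using g_neq[of s j] prems e by (auto simp: run_def)
    moreover have "w j = gen i e (w s)" using e by (simp add: w_def)
    moreover have "length (w s) < L" using prems k by (auto simp: run_def)
    ultimately have "w j = (i, e mod q) # w s" "w j = prepend q i e (w s)"
      using prems(1) by (simp_all add: act_reduced_cons run_def prepend_def)
    moreover have "prepend q i e (w s) \<in> reduced r q L"
      using prems(1) \<open>length (w s) < L\<close> q_pos by (intro prepend_reduced) (auto simp: run_def)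
    ultimately show ?thesis by auto
  qed
  have step: "\<forall>l\<in>{m..Suc m}. \<exists>e. g l = gen i e \<circ> g m" if "g (Suc m) = gen i e \<circ> g m" for i e m
  proof
    fix l assume "l \<in> {m..Suc m}"
    then have "l = m \<or> l = Suc m" by auto
    then show "\<exists>e. g l = gen i e \<circ> g m" using that gen_0 by metis
  qed
  \<comment> \<open>The next edge either prolongs the current run or, coming from another factor,
    starts a new one.\<close>
  have "\<exists>s i. run s (Suc m) i" if "Suc m \<le> k" for m
    using that
  proof (induction m)
    case 0
    obtain i e where "i < r" "g (Suc 0) = gen i e \<circ> g 0" using adj_g[of 0] by (auto simp: adj_def)
    then have "run 0 (Suc 0) i"
      using x step unfolding run_def by (simp add: w_def Nil_reduced strip_Nil)
    then show ?case by blast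
  next
    case (Suc m)
    then obtain s i where run: "run s (Suc m) i" by auto
    then obtain c where c: "w (Suc m) = (i, c) # w s" "w (Suc m) \<in> reduced r q L"
      using run_end Suc.prems by (metis Suc_leD Suc_le_lessD)
    obtain j e where je: "j < r" "g (Suc (Suc m)) = gen j e \<circ> g (Suc m)"
      using adj_g[of "Suc m"] by (auto simp: adj_def)
    show ?case
    proof (cases "j = i")
      case True
      have "Suc m \<in> {s..Suc m}" using run by (simp add: run_def)
      then obtain e' where "g (Suc m) = gen i e' \<circ> g s" using run unfolding run_def by blast
      then have "g (Suc (Suc m)) = gen i (e + e') \<circ> g s"
        using je True act_act[OF je(1) q_pos, of L e e'] by (simp add: o_assoc)
      then have "run s (Suc (Suc m)) i"
        using run unfolding run_def by (auto simp: le_Suc_eq)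
      then show ?thesis by blast
    next
      case False
      \<comment> \<open>The finished run has put a letter of factor \<open>i\<close> in front, so
        \<open>strip j\<close> changes nothing.\<close>
      have "run (Suc m) (Suc (Suc m)) j"
        using run c je(1) False step[OF je(2)] unfolding run_def by (simp add: strip_def)
      then show ?thesis by blast
    qed
  qed
  from this[of "k - 1"] k(1) obtain s i where run: "run s k i" by auto
  show False
  \<comment> \<open>A single run puts all \<open>k\<close> vertices into a coset of at most
    \<open>q < k\<close> elements; otherwise the last run makes \<open>w k\<close> nonempty,
    although \<open>g k = g 0\<close> sends \<open>x\<close> to the empty word.\<close>
  proof (cases "s = 0")
    case True
    have "f ` {..<k} \<subseteq> (\<lambda>e. gen i e \<circ> g 0) ` {..<q}"
    proof clarify
      fix l assume "l < k"
      then have "l \<in> {s..k}" using True by simp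
      then obtain e where "g l = gen i e \<circ> g 0" using run True unfolding run_def by blast
      moreover have "gen i e = gen i (e mod q)" by (rule act_cong_mod) simp
      ultimately have "f l = gen i (e mod q) \<circ> g 0" using \<open>l < k\<close> by (simp add: g_def)
      then show "f l \<in> (\<lambda>e. gen i e \<circ> g 0) ` {..<q}" using q_pos by simp
    qed
    then have "card (f ` {..<k}) \<le> card ((\<lambda>e. gen i e \<circ> g 0) ` {..<q})" by (intro card_mono) auto
    also have "\<dots> \<le> q" using card_image_le[of "{..<q}"] by simp
    finally show False using f(1) k(2) by (simp add: card_image)
  next
    case False
    then obtain e where "w k = (i, e) # w s" using run_end[OF run] by auto
    moreover have "w k = []" using x by (simp add: w_def g_def)
    ultimately show False by simp
  qed
qed

end

section \<open>Sharpness of the bound\<close>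

lemma extremal_graph:
  assumes "t \<ge> 2" "k \<ge> 3"
  shows "\<exists>n \<ge> N. \<exists>F \<in> admissible n (cycle k) (star t). 2 * card (edges F) = (k - 2) * (t - 1) * n"
proof -
  \<comment> \<open>Adding \<open>N\<close> arbitrary words to \<open>S\<close> forces at least
    \<open>N\<close> vertices, their number being the factorial of \<open>card S\<close>.\<close>
  obtain T :: "(nat \<times> nat) list set" where T: "finite T" "card T = N"
    using infinite_arbitrarily_large[of UNIV N] infinite_UNIV_listI by blast
  define S where "S = reduced (t - 1) (k - 1) k \<union> T"
  \<comment> \<open>With \<open>t - 1\<close> factors of order \<open>k - 1\<close> every degree is
    \<open>(t - 1) * (k - 2)\<close>, and words of length up to \<open>k\<close> suffice against
    cycles of length \<open>k\<close>.\<close>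
  interpret clique_graph "t - 1" "k - 1" k S
    using assms T finite_reduced by unfold_locales (auto simp: S_def)
  have card_V: "card V = fact (card S)" using card_permutations[OF refl finite_S] by (simp add: V_def)
  have "N \<le> card S" using T finite_S unfolding S_def by (metis card_mono Un_upper2)
  also have "\<dots> \<le> card V" unfolding card_V by (rule fact_ge_self)
  finally have "N \<le> card V" .
  have "\<exists>F \<in> admissible (card (verts \<Gamma>)) (cycle k) (star t). card (edges F) = card (edges \<Gamma>)"
    using assms by (intro admissible_relabel simple_graph no_cycle no_induced_star) auto
  then obtain F where F: "F \<in> admissible (card V) (cycle k) (star t)" "card (edges F) = card (edges \<Gamma>)"
    unfolding verts by blast
  have "2 * card (edges \<Gamma>) = (\<Sum>v\<in>V. card (nbrs \<Gamma> v))"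
    using sum_degrees[OF simple_graph] unfolding verts by (rule sym)
  also have "\<dots> = (k - 2) * (t - 1) * card V"
    using degree by (simp add: numeral_2_eq_2 mult.commute mult.left_commute)
  finally have "2 * card (edges F) = (k - 2) * (t - 1) * card V" using F(2) by simp
  then show ?thesis using F(1) \<open>N \<le> card V\<close> by blast
qed

theorem theorem4:
  fixes t k :: nat
  assumes "t \<ge> 3" and "k \<ge> 3"
  shows "(\<forall>n\<ge>1. real (ex_ind n (cycle k) (star t)) \<le> 1 / 2 * (real k - 2) * (real t - 1) * real n)
    \<and> infinite {n. n \<ge> 1 \<and>
        real (ex_ind n (cycle k) (star t)) = 1 / 2 * (real k - 2) * (real t - 1) * real n}"
proof -
  \<comment> \<open>Since \<open>k\<close> and \<open>t\<close> are at least 3, the subtractions in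
    \<open>nat\<close> are not truncated.\<close>
  have cast: "real ((k - 2) * (t - 1) * n) = (real k - 2) * (real t - 1) * real n" for n
    using assms by (simp add: of_nat_diff)
  have upper: "real (ex_ind n (cycle k) (star t)) \<le> 1 / 2 * (real k - 2) * (real t - 1) * real n" for n
  proof -
    have "2 * real (ex_ind n (cycle k) (star t)) \<le> real ((k - 2) * (t - 1) * n)"
      using of_nat_mono[OF ex_ind_upper[OF assms(2,1), of n], where ?'a = real] by simp
    then show ?thesis unfolding cast by simp
  qed
  \<comment> \<open>Equality at arbitrarily large \<open>n\<close> gives infinitely many, as a
    finite set of naturals is bounded.\<close>
  have "\<exists>n\<ge>N. n \<ge> 1 \<and> real (ex_ind n (cycle k) (star t)) = 1 / 2 * (real k - 2) * (real t - 1) * real n"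
    for N
  proof -
    obtain n F where n: "n \<ge> max N 1" and F: "F \<in> admissible n (cycle k) (star t)"
        "2 * card (edges F) = (k - 2) * (t - 1) * n"
      using extremal_graph[of t k "max N 1"] assms by auto
    have "card (edges F) \<le> ex_ind n (cycle k) (star t)"
      unfolding ex_ind_def using F(1) by (intro Max_ge finite_edge_counts) auto
    then have "2 * ex_ind n (cycle k) (star t) = (k - 2) * (t - 1) * n"
      using F(2) ex_ind_upper[OF assms(2,1), of n] by linarith
    then have "2 * real (ex_ind n (cycle k) (star t)) = (real k - 2) * (real t - 1) * real n"
      unfolding cast[symmetric] by (metis of_nat_mult of_nat_numeral)
    then show ?thesis using n by (intro exI[of _ n]) auto
  qed
  then have "infinite {n. n \<ge> 1 \<and>
      real (ex_ind n (cycle k) (star t)) = 1 / 2 * (real k - 2) * (real t - 1) * real n}"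
    unfolding finite_nat_set_iff_bounded by (auto simp: not_less)
  with upper show ?thesis by blast
qed

end
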